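(* Let $f\colon\mathbb F_2^n\to\{+1,-1\}$ be non-linear and at most $1/10$-far from linear. Then $D^{\rightarrow}_{1/200}(f^+)>1$.
   Context: $\chi_S(x)=(-1)^{S\cdot x}$ for $S\in\mathbb F_2^n$. $f$ is non-linear if for every $S\in\mathbb F_2^n$ there is $x$ with $f(x)\ne\chi_S(x)$. $f$ is $\epsilon$-far from linear if $\max_{S\in\mathbb F_2^n}\Pr_{x\sim U(\mathbb F_2^n)}[\chi_S(x)=f(x)]=1-\epsilon$; "at most $1/10$-far" means this $\epsilon\le1/10$. $f^+(x,y)=f(x+y)$. For a distribution $\mu$ on $\mathbb F_2^n\times\mathbb F_2^n$ and $F\colon\mathbb F_2^n\times\mathbb F_2^n\to\{\pm1\}$, $D^{\rightarrow,\mu}_\delta(F)$ is the smallest $t$ such that there are $M\colon\mathbb F_2^n\to\{0,1\}^t$ (Alice's message) and $h\colon\{0,1\}^t\times\mathbb F_2^n\to\{\pm1\}$ with $\Pr_{(x,y)\sim\mu}[h(M(x),y)=F(x,y)]\ge1-\delta$; $D^{\rightarrow}_\delta(F)=\sup_\mu D^{\rightarrow,\mu}_\delta(F)$ (which equals the randomized public-coin one-way communication complexity with error $\delta$). *)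

theory Defs
  imports "HOL-Probability.Probability" "HOL-Library.Z2" "HOL-Library.Extended_Nat"
begin

instance bit :: finite
proof
  have "(UNIV :: bit set) = {0, 1}"
    by (auto intro: bit.exhaust)
  then show "finite (UNIV :: bit set)"
    by (metis finite.emptyI finite.insertI)
qed

text \<open>
  The space of dimension \<open>n = CARD('n)\<close> over the two-element field is \<open>bit ^ 'n\<close>.
  Sign-valued functions are integer-valued with values in \<open>{1, -1}\<close>.
\<close>

definition dot :: "bit ^ 'n \<Rightarrow> bit ^ 'n \<Rightarrow> bit" where
  "dot S x = (\<Sum>i\<in>UNIV. S $ i * x $ i)"

definition chi :: "bit ^ 'n \<Rightarrow> bit ^ 'n \<Rightarrow> int" where
  "chi S x = (-1) ^ (of_bit (dot S x) :: nat)"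

definition non_linear :: "(bit ^ 'n \<Rightarrow> int) \<Rightarrow> bool" where
  "non_linear f \<longleftrightarrow> (\<forall>S. \<exists>x. f x \<noteq> chi S x)"

definition far_from_linear :: "real \<Rightarrow> (bit ^ 'n \<Rightarrow> int) \<Rightarrow> bool" where
  "far_from_linear \<epsilon> f \<longleftrightarrow>
     (MAX S. measure_pmf.prob (pmf_of_set UNIV) {x. chi S x = f x}) = 1 - \<epsilon>"

definition xor_lift :: "(bit ^ 'n \<Rightarrow> int) \<Rightarrow> (bit ^ 'n) \<times> (bit ^ 'n) \<Rightarrow> int" where
  "xor_lift f = (\<lambda>(x, y). f (x + y))"

definition oneway_protocol ::
  "real \<Rightarrow> ((bit ^ 'n) \<times> (bit ^ 'n)) pmf \<Rightarrow> ((bit ^ 'n) \<times> (bit ^ 'n) \<Rightarrow> int) \<Rightarrow> nat \<Rightarrow>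
   (bit ^ 'n \<Rightarrow> bool list) \<Rightarrow> (bool list \<times> (bit ^ 'n) \<Rightarrow> int) \<Rightarrow> bool" where
  "oneway_protocol \<delta> \<mu> F t M h \<longleftrightarrow>
     M \<in> UNIV \<rightarrow> {m. length m = t} \<and>
     h \<in> {m. length m = t} \<times> UNIV \<rightarrow> {1, -1} \<and>
     measure_pmf.prob \<mu> {(x, y). h (M x, y) = F (x, y)} \<ge> 1 - \<delta>"

text \<open>
  For sign-valued \<open>F\<close> and \<open>\<delta> \<ge> 0\<close> the minimum below is attained, since sending all of \<open>x\<close> works
  with \<open>t = CARD('n)\<close> (lemma \<open>oneway_protocol_exists\<close>).
\<close>

definition oneway_complexity_dist ::
  "real \<Rightarrow> ((bit ^ 'n) \<times> (bit ^ 'n)) pmf \<Rightarrow> ((bit ^ 'n) \<times> (bit ^ 'n) \<Rightarrow> int) \<Rightarrow> nat" where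
  "oneway_complexity_dist \<delta> \<mu> F = (LEAST t. \<exists>M h. oneway_protocol \<delta> \<mu> F t M h)"

definition oneway_complexity ::
  "real \<Rightarrow> ((bit ^ 'n) \<times> (bit ^ 'n) \<Rightarrow> int) \<Rightarrow> enat" where
  "oneway_complexity \<delta> F = (SUP \<mu>. enat (oneway_complexity_dist \<delta> \<mu> F))"

lemma oneway_protocol_exists:
  fixes F :: "(bit ^ 'n) \<times> (bit ^ 'n) \<Rightarrow> int"
  assumes F: "range F \<subseteq> {1, -1}" and "\<delta> \<ge> 0"
  shows "\<exists>M h. oneway_protocol \<delta> \<mu> F CARD('n) M h"
proof -
  obtain l :: "'n list" where l: "set l = UNIV" "distinct l"
    using finite_distinct_list[of "UNIV :: 'n set"] by auto
  define M where "M = (\<lambda>x :: bit ^ 'n. map (\<lambda>i. odd (x $ i)) l)"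
  define h where "h = (\<lambda>(m, y). F (inv M m, y))"
  have len: "length l = CARD('n)"
    using l distinct_card by fastforce
  have inj: "inj M"
  proof (rule injI)
    fix x y assume "M x = M y"
    then have "odd (x $ i) = odd (y $ i)" for i
      using l by (auto simp: M_def)
    then show "x = y"
      by (metis Z2.bit_eq_iff vec_eq_iff)
  qed
  have "{(x, y). h (M x, y) = F (x, y)} = UNIV"
    by (auto simp: h_def inv_f_f[OF inj])
  moreover have "h \<in> {m. length m = CARD('n)} \<times> UNIV \<rightarrow> {1, -1}"
    using F by (auto simp: h_def)
  ultimately have "oneway_protocol \<delta> \<mu> F CARD('n) M h"
    using \<open>\<delta> \<ge> 0\<close> by (simp add: oneway_protocol_def M_def len)
  then show ?thesis by blast
qed

end

theory Submission
  imports Defs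
begin

text \<open>
  Fix a character \<open>\<phi>\<close> that agrees with \<open>f\<close> outside a nonempty set \<open>A\<close> of density at most \<open>1/10\<close>.
  The hard distribution is, with probability \<open>1/2\<close> each, a uniform pair \<open>(x, y)\<close> or a uniform
  pair with \<open>x + y \<in> A\<close>. A correct protocol mostly outputs \<open>\<phi> (x + y)\<close> on the first half but
  mostly differs from it on the second. Since \<open>\<phi> (x + y) = \<phi> x * \<phi> y\<close>, outputting
  \<open>\<phi> (x + y)\<close> amounts to guessing \<open>\<phi> x\<close> from the message and \<open>y\<close>, and in both halves \<open>x\<close> and
  \<open>y\<close> are separately uniform. So it suffices to bound the error of a guess on a coupling by its
  error on the product of the marginals. Averaging yields a \<open>y\<^sub>0\<close> whose guesses, which depend on
  the message only, are good; for independent \<open>x\<close> and \<open>y\<close> the guess at \<open>y\<close> rarely deviates from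
  the guess at \<open>y\<^sub>0\<close>. By Cauchy-Schwarz, an event about \<open>y\<close> and one of \<open>k\<close> messages that has
  probability \<open>p\<close> under independence has probability at most \<open>sqrt (k * p)\<close> in any coupling.
\<close>

lemma measure_bind_pmf:
  "measure_pmf.prob (bind_pmf p K) E = measure_pmf.expectation p (\<lambda>x. measure_pmf.prob (K x) E)"
  by (simp add: measure_pmf_bind measure_pmf.measure_bind[where N = "count_space UNIV"]
      measure_pmf_in_subprob_algebra)

lemma measure_pair_pmf_Times:
  "measure_pmf.prob (pair_pmf p q) (A \<times> B) = measure_pmf.prob p A * measure_pmf.prob q B"
proof -
  have "pair_pmf p q = bind_pmf p (\<lambda>x. map_pmf (Pair x) q)"
    by (simp add: pair_pmf_def map_pmf_def)
  moreover have "measure_pmf.prob (map_pmf (Pair x) q) (A \<times> B)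
      = measure_pmf.prob q B * indicator A x" for x
    by (simp add: indicator_def vimage_def)
  ultimately show ?thesis
    by (simp add: measure_bind_pmf)
qed

lemma measure_pair_pmf_section_leE:
  obtains y where "measure_pmf.prob p {x. (x, y) \<in> E} \<le> measure_pmf.prob (pair_pmf p q) E"
proof -
  have "pair_pmf p q = bind_pmf q (\<lambda>y. map_pmf (\<lambda>x. (x, y)) p)"
    unfolding pair_pmf_def map_pmf_def by (rule bind_commute_pmf)
  then have average: "measure_pmf.prob (pair_pmf p q) E
      = measure_pmf.expectation q (\<lambda>y. measure_pmf.prob p {x. (x, y) \<in> E})"
    by (simp add: measure_bind_pmf vimage_def)
  have "integrable (measure_pmf q) (\<lambda>y. measure_pmf.prob p {x. (x, y) \<in> E})"
    by (rule measure_pmf.integrable_const_bound[where B = 1]) auto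
  then have "\<exists>y. measure_pmf.prob p {x. (x, y) \<in> E} \<le> measure_pmf.prob (pair_pmf p q) E"
    using measure_pmf.expectation_greater[of q] by (force simp: average not_le)
  then show thesis using that by blast
qed

lemma measure_pmf_eq_sum_sections:
  assumes "finite T" "fst ` set_pmf \<nu> \<subseteq> T"
  shows "measure_pmf.prob \<nu> E = (\<Sum>a\<in>T. measure_pmf.prob \<nu> ({a} \<times> E `` {a}))"
proof -
  have "measure_pmf.prob \<nu> E = measure_pmf.prob \<nu> (\<Union>a\<in>T. {a} \<times> E `` {a})"
    using assms(2) by (intro measure_pmf.finite_measure_eq_AE) (auto simp: AE_measure_pmf_iff)
  also have "\<dots> = (\<Sum>a\<in>T. measure_pmf.prob \<nu> ({a} \<times> E `` {a}))"
    using assms(1)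
    by (intro measure_pmf.finite_measure_finite_Union) (auto simp: disjoint_family_on_def)
  finally show ?thesis .
qed

definition decouple_pmf :: "('a \<times> 'b) pmf \<Rightarrow> ('a \<times> 'b) pmf" where
  "decouple_pmf \<nu> = pair_pmf (map_pmf fst \<nu>) (map_pmf snd \<nu>)"

lemma decouple_map_pmf_apfst:
  "decouple_pmf (map_pmf (apfst g) \<nu>) = map_pmf (apfst g) (decouple_pmf \<nu>)"
  by (simp add: decouple_pmf_def pmf.map_comp o_def flip: pair_map_pmf1)

lemma measure_Times_squared_le_decouple_pmf:
  "(measure_pmf.prob \<nu> (A \<times> B))\<^sup>2 \<le> measure_pmf.prob (decouple_pmf \<nu>) (A \<times> B)"
proof -
  have "measure_pmf.prob \<nu> (A \<times> B) \<le> measure_pmf.prob \<nu> (fst -` A)"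
    "measure_pmf.prob \<nu> (A \<times> B) \<le> measure_pmf.prob \<nu> (snd -` B)"
    by (auto intro: measure_pmf.finite_measure_mono)
  then show ?thesis
    by (simp add: decouple_pmf_def measure_pair_pmf_Times power2_eq_square mult_mono)
qed

lemma measure_pmf_le_sqrt_decouple_pmf:
  assumes "finite T" "fst ` set_pmf \<nu> \<subseteq> T"
  shows "measure_pmf.prob \<nu> E \<le> sqrt (card T * measure_pmf.prob (decouple_pmf \<nu>) E)"
proof (rule real_le_rsqrt)
  let ?section = "\<lambda>a. {a} \<times> E `` {a}"
  have "(measure_pmf.prob \<nu> E)\<^sup>2 = (\<Sum>a\<in>T. measure_pmf.prob \<nu> (?section a))\<^sup>2"
    by (simp add: measure_pmf_eq_sum_sections[OF assms, of E])
  also have "\<dots> \<le> card T * (\<Sum>a\<in>T. (measure_pmf.prob \<nu> (?section a))\<^sup>2)"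
    using sum_squared_le_sum_of_squares[of _ T] by (simp add: mult.commute)
  also have "\<dots> \<le> card T * (\<Sum>a\<in>T. measure_pmf.prob (decouple_pmf \<nu>) (?section a))"
    by (intro mult_left_mono sum_mono measure_Times_squared_le_decouple_pmf) simp
  also have "\<dots> = card T * measure_pmf.prob (decouple_pmf \<nu>) E"
    using assms
    by (subst measure_pmf_eq_sum_sections[of T "decouple_pmf \<nu>" E]) (auto simp: decouple_pmf_def)
  finally show "(measure_pmf.prob \<nu> E)\<^sup>2 \<le> card T * measure_pmf.prob (decouple_pmf \<nu>) E" .
qed

lemma guess_error_le_decouple_pmf:
  fixes \<nu> :: "('a \<times> 'b) pmf" and M :: "'a \<Rightarrow> 'm"
    and guess :: "'m \<Rightarrow> 'b \<Rightarrow> 'c" and target :: "'a \<Rightarrow> 'c" and \<eta> :: real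
  defines "err \<equiv> {(x, y). guess (M x) y \<noteq> target x}"
  defines "\<eta> \<equiv> measure_pmf.prob (decouple_pmf \<nu>) err"
  assumes "finite T" "range M \<subseteq> T"
  shows "measure_pmf.prob \<nu> err \<le> \<eta> + sqrt (2 * card T * \<eta>)"
proof -
  let ?P = "measure_pmf.prob \<nu>" and ?Q = "measure_pmf.prob (decouple_pmf \<nu>)"
  obtain y\<^sub>0 where y\<^sub>0: "measure_pmf.prob (map_pmf fst \<nu>) {x. (x, y\<^sub>0) \<in> err} \<le> \<eta>"
    unfolding \<eta>_def decouple_pmf_def by (rule measure_pair_pmf_section_leE)
  define misled where "misled = {x. guess (M x) y\<^sub>0 \<noteq> target x}"
  define deviation where "deviation = {(m, y). guess m y \<noteq> guess m y\<^sub>0}"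
  have misled: "measure_pmf.prob (map_pmf fst \<nu>) misled \<le> \<eta>"
    using y\<^sub>0 by (simp add: err_def misled_def)
  then have P_misled: "?P (fst -` misled) \<le> \<eta>"
    by simp
  have Q_misled: "?Q (fst -` misled) \<le> \<eta>"
    using misled by (simp add: decouple_pmf_def map_fst_pair_pmf flip: measure_map_pmf)
  have "?Q (apfst M -` deviation) \<le> ?Q (err \<union> fst -` misled)"
    by (intro measure_pmf.finite_measure_mono) (auto simp: deviation_def err_def misled_def)
  also have "\<dots> \<le> ?Q err + ?Q (fst -` misled)"
    by (intro measure_Un_le) simp_all
  also have "\<dots> \<le> 2 * \<eta>"
    using Q_misled by (simp add: \<eta>_def)
  finally have Q_deviation: "?Q (apfst M -` deviation) \<le> 2 * \<eta>" .
  have "fst ` set_pmf (map_pmf (apfst M) \<nu>) \<subseteq> T"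
    using \<open>range M \<subseteq> T\<close> by auto
  with \<open>finite T\<close> have P_deviation:
    "?P (apfst M -` deviation) \<le> sqrt (card T * ?Q (apfst M -` deviation))"
    using measure_pmf_le_sqrt_decouple_pmf[of T "map_pmf (apfst M) \<nu>" deviation]
    by (simp add: decouple_map_pmf_apfst)
  have "?P err \<le> ?P (fst -` misled \<union> apfst M -` deviation)"
    by (intro measure_pmf.finite_measure_mono) (auto simp: deviation_def err_def misled_def)
  also have "\<dots> \<le> ?P (fst -` misled) + ?P (apfst M -` deviation)"
    by (intro measure_Un_le) simp_all
  also have "\<dots> \<le> \<eta> + sqrt (card T * ?Q (apfst M -` deviation))"
    by (intro add_mono P_misled P_deviation)
  also have "\<dots> \<le> \<eta> + sqrt (card T * (2 * \<eta>))"
    using Q_deviation by (simp add: mult_left_mono)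
  finally show ?thesis
    by (simp add: mult_ac)
qed

abbreviation uniform_pmf :: "'a::finite pmf" where
  "uniform_pmf \<equiv> pmf_of_set UNIV"

lemma map_pmf_pair_uniform_bij:
  fixes g :: "'s \<Rightarrow> 'a::finite \<Rightarrow> 'a"
  assumes "\<And>s. bij (g s)"
  shows "map_pmf (\<lambda>(x, s). g s x) (pair_pmf uniform_pmf D) = uniform_pmf"
proof -
  have "map_pmf (\<lambda>(x, s). g s x) (pair_pmf uniform_pmf D)
      = bind_pmf D (\<lambda>s. map_pmf (g s) uniform_pmf)"
    by (subst pair_commute_pmf)
      (simp add: pair_pmf_def map_bind_pmf bind_assoc_pmf bind_return_pmf map_pmf_def)
  also have "\<dots> = uniform_pmf"
    by (simp add: map_pmf_of_set_bij_betw[OF assms])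
  finally show ?thesis .
qed

definition sum_coupling :: "'a::{finite,ab_group_add} pmf \<Rightarrow> ('a \<times> 'a) pmf" where
  "sum_coupling D = map_pmf (\<lambda>(x, s). (x, s - x)) (pair_pmf uniform_pmf D)"

lemma map_pmf_plus_sum_coupling: "map_pmf (\<lambda>(x, y). x + y) (sum_coupling D) = D"
  by (simp add: sum_coupling_def pmf.map_comp o_def case_prod_unfold map_snd_pair_pmf)

lemma decouple_sum_coupling:
  "decouple_pmf (sum_coupling D) = pair_pmf uniform_pmf uniform_pmf"
proof -
  have "map_pmf fst (sum_coupling D) = uniform_pmf"
    by (simp add: sum_coupling_def pmf.map_comp o_def case_prod_unfold map_fst_pair_pmf)
  moreover have "map_pmf snd (sum_coupling D) = uniform_pmf"
    using map_pmf_pair_uniform_bij[of "\<lambda>s x. s - x" D]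
    by (simp add: sum_coupling_def pmf.map_comp o_def case_prod_unfold bij_diff)
  ultimately show ?thesis by (simp add: decouple_pmf_def)
qed

lemma map_pmf_plus_pair_uniform:
  fixes D :: "'a::{finite,ab_group_add} pmf"
  shows "map_pmf (\<lambda>(x, y). x + y) (pair_pmf uniform_pmf D) = uniform_pmf"
  using map_pmf_pair_uniform_bij[of "\<lambda>s x. x + s" D] by (simp add: bij_plus_right)

lemma character_guess_error_le_sum_coupling:
  fixes \<phi> :: "'a::{finite,ab_group_add} \<Rightarrow> 'c::monoid_mult" and M :: "'a \<Rightarrow> 'm"
    and h :: "'m \<Rightarrow> 'a \<Rightarrow> 'c" and \<eta> :: real
  defines "err \<equiv> {(x, y). h (M x) y \<noteq> \<phi> (x + y)}"
  defines "\<eta> \<equiv> measure_pmf.prob (pair_pmf uniform_pmf uniform_pmf) err"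
  assumes \<phi>: "\<phi> 0 = 1" "\<And>x y. \<phi> (x + y) = \<phi> x * \<phi> y"
    and T: "finite T" "range M \<subseteq> T"
  shows "measure_pmf.prob (sum_coupling D) err \<le> \<eta> + sqrt (2 * card T * \<eta>)"
proof -
  have inverse: "\<phi> y * \<phi> (- y) = 1" "\<phi> (- y) * \<phi> y = 1" for y
    by (simp_all add: \<phi>(1) flip: \<phi>(2))
  have "h m y = \<phi> x * \<phi> y \<longleftrightarrow> h m y * \<phi> (- y) = \<phi> x" for m x y
    by (metis inverse mult.assoc mult.right_neutral)
  then have "err = {(x, y). h (M x) y * \<phi> (- y) \<noteq> \<phi> x}"
    by (simp add: err_def \<phi>(2))
  then show ?thesis
    using guess_error_le_decouple_pmf[OF T, of "sum_coupling D" "\<lambda>m y. h m y * \<phi> (- y)" \<phi>]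
    by (simp add: \<eta>_def decouple_sum_coupling)
qed

definition hard_pmf :: "'a::{finite,ab_group_add} set \<Rightarrow> ('a \<times> 'a) pmf" where
  "hard_pmf A = bind_pmf (bernoulli_pmf (1/2)) (\<lambda>c.
     if c then pair_pmf uniform_pmf uniform_pmf else sum_coupling (pmf_of_set A))"

lemma measure_hard_pmf:
  "measure_pmf.prob (hard_pmf A) E
    = (measure_pmf.prob (pair_pmf uniform_pmf uniform_pmf) E
       + measure_pmf.prob (sum_coupling (pmf_of_set A)) E) / 2"
  by (simp add: hard_pmf_def measure_bind_pmf)

lemma hard_pmf_error_bound:
  fixes f \<phi> :: "'a::{finite,ab_group_add} \<Rightarrow> 'c::monoid_mult" and M :: "'a \<Rightarrow> 'm"
    and h :: "'m \<Rightarrow> 'a \<Rightarrow> 'c" and e \<eta> :: real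
  defines "A \<equiv> {x. f x \<noteq> \<phi> x}"
  defines "e \<equiv> measure_pmf.prob (hard_pmf A) {(x, y). h (M x) y \<noteq> f (x + y)}"
  defines "\<eta> \<equiv> measure_pmf.prob uniform_pmf A + 2 * e"
  assumes \<phi>: "\<phi> 0 = 1" "\<And>x y. \<phi> (x + y) = \<phi> x * \<phi> y"
    and T: "finite T" "range M \<subseteq> T" and "A \<noteq> {}"
  shows "1 \<le> 2 * e + (\<eta> + sqrt (2 * card T * \<eta>))"
proof -
  let ?U = "measure_pmf.prob (pair_pmf uniform_pmf uniform_pmf)"
    and ?C = "measure_pmf.prob (sum_coupling (pmf_of_set A))"
  define wrong where "wrong = {(x, y). h (M x) y \<noteq> f (x + y)}"
  define err where "err = {(x, y). h (M x) y \<noteq> \<phi> (x + y)}"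
  define biased where "biased = {(x, y). x + y \<in> A}"
  have biased_vimage: "biased = (\<lambda>(x, y). x + y) -` A"
    by (auto simp: biased_def)
  have U_wrong: "?U wrong \<le> 2 * e" and C_wrong: "?C wrong \<le> 2 * e"
    by (simp_all add: e_def wrong_def measure_hard_pmf)
  have "?U err \<le> ?U (wrong \<union> biased)"
    by (intro measure_pmf.finite_measure_mono) (auto simp: wrong_def err_def biased_def A_def)
  also have "\<dots> \<le> ?U wrong + ?U biased"
    by (intro measure_Un_le) simp_all
  also have "?U biased = measure_pmf.prob uniform_pmf A"
    unfolding biased_vimage by (simp flip: measure_map_pmf add: map_pmf_plus_pair_uniform)
  finally have U_err: "?U err \<le> \<eta>"
    using U_wrong by (simp add: \<eta>_def)
  have "1 = ?C biased"
    unfolding biased_vimage using \<open>A \<noteq> {}\<close>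
    by (simp flip: measure_map_pmf add: map_pmf_plus_sum_coupling measure_pmf_of_set)
  also have "\<dots> \<le> ?C (wrong \<union> err)"
    by (intro measure_pmf.finite_measure_mono) (auto simp: wrong_def err_def biased_def A_def)
  also have "\<dots> \<le> ?C wrong + ?C err"
    by (intro measure_Un_le) simp_all
  also have "\<dots> \<le> 2 * e + (?U err + sqrt (2 * card T * ?U err))"
    unfolding err_def
    by (intro add_mono C_wrong character_guess_error_le_sum_coupling[OF \<phi> T])
  also have "\<dots> \<le> 2 * e + (\<eta> + sqrt (2 * card T * \<eta>))"
    using U_err by (intro add_mono real_sqrt_le_mono mult_left_mono) simp_all
  finally show ?thesis .
qed

lemma chi_zero: "chi S 0 = 1"
  by (simp add: chi_def dot_def)

lemma chi_add: "chi S (x + y) = chi S x * chi S y"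
proof -
  have "dot S (x + y) = dot S x + dot S y"
    unfolding dot_def by (simp only: vector_add_component distrib_left sum.distrib)
  then show ?thesis
    unfolding chi_def by (cases "dot S x"; cases "dot S y") simp_all
qed

lemma far_from_linearE:
  assumes "far_from_linear \<epsilon> f"
  obtains S where "measure_pmf.prob uniform_pmf {x. f x \<noteq> chi S x} = \<epsilon>"
proof -
  let ?agreement = "\<lambda>S. measure_pmf.prob uniform_pmf {x. chi S x = f x}"
  have "Max (range ?agreement) \<in> range ?agreement"
    by (intro Max_in) auto
  then obtain S where "?agreement S = 1 - \<epsilon>"
    using assms unfolding far_from_linear_def by (metis (lifting) rangeE)
  moreover have "{x. f x \<noteq> chi S x} = - {x. chi S x = f x}"
    by auto
  ultimately have "measure_pmf.prob uniform_pmf {x. f x \<noteq> chi S x} = \<epsilon>"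
    by (simp add: measure_pmf.prob_compl[of "{x. chi S x = f x}", simplified] Compl_eq_Diff_UNIV)
  then show thesis using that by blast
qed

lemma oneway_protocol_hard_pmf_bound:
  fixes f :: "bit ^ 'n \<Rightarrow> int" and S :: "bit ^ 'n" and \<delta> \<eta> :: real
  defines "A \<equiv> {x. f x \<noteq> chi S x}"
  defines "\<eta> \<equiv> measure_pmf.prob uniform_pmf A + 2 * \<delta>"
  assumes "A \<noteq> {}" and protocol: "oneway_protocol \<delta> (hard_pmf A) (xor_lift f) t M h"
  shows "1 \<le> 2 * \<delta> + (\<eta> + sqrt (2 * 2 ^ t * \<eta>))"
proof -
  let ?messages = "{m :: bool list. length m = t}"
    and ?correct = "{(x, y). h (M x, y) = f (x + y)}"
  have messages: "finite ?messages" "range M \<subseteq> ?messages" "card ?messages = 2 ^ t"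
    using protocol finite_lists_length_eq[of "UNIV :: bool set" t]
      card_lists_length_eq[of "UNIV :: bool set" t] by (auto simp: oneway_protocol_def)
  define e where "e = measure_pmf.prob (hard_pmf A) {(x, y). h (M x, y) \<noteq> f (x + y)}"
  have "{(x, y). h (M x, y) \<noteq> f (x + y)} = - ?correct"
    by auto
  then have "e = 1 - measure_pmf.prob (hard_pmf A) ?correct"
    using measure_pmf.prob_compl[of ?correct] by (simp add: e_def Compl_eq_Diff_UNIV)
  then have "e \<le> \<delta>"
    using protocol by (simp add: oneway_protocol_def xor_lift_def)
  let ?\<eta>' = "measure_pmf.prob uniform_pmf A + 2 * e"
  have "1 \<le> 2 * e + (?\<eta>' + sqrt (2 * 2 ^ t * ?\<eta>'))"
    using hard_pmf_error_bound[OF chi_zero[of S] chi_add messages(1,2),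
        where f = f and h = "\<lambda>m y. h (m, y)"] \<open>A \<noteq> {}\<close>
    by (simp add: messages(3) A_def e_def)
  also have "\<dots> \<le> 2 * \<delta> + (\<eta> + sqrt (2 * 2 ^ t * \<eta>))"
    using \<open>e \<le> \<delta>\<close> unfolding \<eta>_def
    by (intro add_mono real_sqrt_le_mono mult_left_mono) simp_all
  finally show ?thesis .
qed

lemma less_oneway_complexityI:
  fixes F :: "(bit ^ 'n) \<times> (bit ^ 'n) \<Rightarrow> int"
  assumes "range F \<subseteq> {1, -1}" "\<delta> \<ge> 0"
    and no_protocol: "\<And>t M h. t \<le> k \<Longrightarrow> \<not> oneway_protocol \<delta> \<mu> F t M h"
  shows "enat k < oneway_complexity \<delta> F"
proof -
  have "\<exists>M h. oneway_protocol \<delta> \<mu> F (oneway_complexity_dist \<delta> \<mu> F) M h"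
    unfolding oneway_complexity_dist_def
    using oneway_protocol_exists[OF assms(1,2)] by (rule LeastI)
  then have "enat k < enat (oneway_complexity_dist \<delta> \<mu> F)"
    using no_protocol by (meson enat_ord_simps(2) not_le_imp_less)
  then show ?thesis
    by (auto simp: oneway_complexity_def less_SUP_iff)
qed

theorem theorem7p1:
  fixes f :: "bit ^ 'n \<Rightarrow> int" and \<epsilon> :: real
  assumes "range f \<subseteq> {1, -1}"
    and "non_linear f"
    and "far_from_linear \<epsilon> f" and "\<epsilon> \<le> 1/10"
  shows "oneway_complexity (1/200) (xor_lift f) > 1"
proof -
  obtain S where \<epsilon>: "measure_pmf.prob uniform_pmf {x. f x \<noteq> chi S x} = \<epsilon>"
    using assms(3) by (rule far_from_linearE)
  have "{x. f x \<noteq> chi S x} \<noteq> {}"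
    using assms(2) by (simp add: non_linear_def)
  show ?thesis
    unfolding one_enat_def
  proof (rule less_oneway_complexityI)
    show "range (xor_lift f) \<subseteq> {1, -1}"
      using assms(1) by (auto simp: xor_lift_def)
  next
    fix t :: nat and M h
    let ?\<eta> = "\<epsilon> + 2 * (1/200)"
    assume "t \<le> 1"
    then have "2 * 2 ^ t * ?\<eta> \<le> 2 * 2 ^ 1 * (11/100)"
      using \<epsilon> \<open>\<epsilon> \<le> 1/10\<close> by (intro mult_mono power_increasing) auto
    then have "sqrt (2 * 2 ^ t * ?\<eta>) \<le> 7/10"
      by (intro real_le_lsqrt) (auto simp: power2_eq_square)
    then have "\<not> 1 \<le> 2 * (1/200) + (?\<eta> + sqrt (2 * 2 ^ t * ?\<eta>))"
      using \<open>\<epsilon> \<le> 1/10\<close> by simp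
    then show "\<not> oneway_protocol (1/200) (hard_pmf {x. f x \<noteq> chi S x}) (xor_lift f) t M h"
      using oneway_protocol_hard_pmf_bound[OF \<open>{x. f x \<noteq> chi S x} \<noteq> {}\<close>] unfolding \<epsilon> by blast
  qed simp
qed

end
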